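(* Let $A$ be a $B_1$-algebra, and for $f\in A$ let $D(f):=\{\mathcal P\in Pr_s(A)\mid f\notin\mathcal P\}$. Then: 1. Each $D(f)$ ($f\in A$) is open and quasi-compact in $Pr_s(A)$. 2. The family $(D(f))_{f\in A}$ is an open basis for $Pr_s(A)$; in particular, the open quasi-compact sets constitute an open basis. 3. A subset $O$ of $Pr_s(A)$ is open and quasi-compact if and only if its complement $Pr_s(A)\setminus O$ is of the form $Pr_s(A)\cap W(I)$ for $I$ an ideal of finite type (i.e. finitely generated) in $A$. 4. The family of open quasi-compact subsets of $Pr_s(A)$ is stable under finite intersections. 5. Each irreducible closed set in $Pr_s(A)$ has a unique generic point.
   Context: A (commutative) $B_1$-algebra is a commutative semiring $A$ with $0$ (absorbing for multiplication) and $1$, in which $1+1=1$ (so $x+x=x$ for all $x\in A$). An ideal of $A$ is a subset containing $0$, stable under addition and under multiplication by elements of $A$. The ideal $\langle S\rangle$ generated by $S\subseteq A$ is the smallest ideal containing $S$; an ideal is of finite type if it is generated by a finite set. An ideal $\mathcal P$ is prime if $\mathcal P\neq A$ and $ab\in\mathcal P$ implies $a\in\mathcal P$ or $b\in\mathcal P$. A congruence on $A$ is an equivalence relation compatible with addition and multiplication. For a congruence $\mathcal R$, $I(\mathcal R):=\{x\in A\mid x\,\mathcal R\,0\}$, an ideal. An ideal $J$ is saturated if $J=I(\mathcal R)$ for some congruence $\mathcal R$. $Pr(A)$ is the set of prime ideals and $Pr_s(A)$ the set of saturated prime ideals. The closed sets of $Pr(A)$ are the sets $W(S):=\{\mathcal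 P\in Pr(A)\mid S\subseteq\mathcal P\}$, $S\subseteq A$; $Pr_s(A)$ carries the induced topology. Quasi-compact means every open cover has a finite subcover (no separation assumed). Irreducible closed sets are nonempty by convention; a generic point of a closed set $F$ is a point whose closure is $F$. *)

theory Defs
  imports "HOL-Analysis.Elementary_Topology" "HOL-Analysis.Abstract_Topology"
begin

text \<open>
  The class \<open>comm_semiring_1\<close> would additionally impose \<open>0 \<noteq> 1\<close>; the trivial
  algebra is allowed here, so \<open>0\<close> and \<open>1\<close> are taken from \<open>comm_semiring_0\<close> and
  \<open>comm_monoid_mult\<close> instead.
\<close>
class b1_algebra = comm_semiring_0 + comm_monoid_mult +
  assumes one_plus_one: "1 + 1 = 1"

lemma b1_add_idem: "x + x = (x :: 'a :: b1_algebra)"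
  by (metis distrib_left mult.right_neutral one_plus_one)

definition b1_ideal :: "'a :: b1_algebra set \<Rightarrow> bool" where
  "b1_ideal I \<longleftrightarrow> 0 \<in> I \<and> (\<forall>x\<in>I. \<forall>y\<in>I. x + y \<in> I) \<and> (\<forall>a. \<forall>x\<in>I. a * x \<in> I)"

definition ideal_generated_by :: "'a :: b1_algebra set \<Rightarrow> 'a set" where
  "ideal_generated_by S = b1_ideal hull S"

lemma b1_ideal_ideal_generated_by: "b1_ideal (ideal_generated_by S)"
  unfolding ideal_generated_by_def
  by (rule hull_in) (auto simp: b1_ideal_def)

definition finite_type_ideal :: "'a :: b1_algebra set \<Rightarrow> bool" where
  "finite_type_ideal I \<longleftrightarrow> (\<exists>S. finite S \<and> I = ideal_generated_by S)"

definition b1_prime_ideal :: "'a :: b1_algebra set \<Rightarrow> bool" where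
  "b1_prime_ideal P \<longleftrightarrow> b1_ideal P \<and> P \<noteq> UNIV \<and> (\<forall>a b. a * b \<in> P \<longrightarrow> a \<in> P \<or> b \<in> P)"

definition b1_congruence :: "('a :: b1_algebra \<times> 'a) set \<Rightarrow> bool" where
  "b1_congruence R \<longleftrightarrow> equiv UNIV R \<and>
     (\<forall>a b c d. (a, b) \<in> R \<longrightarrow> (c, d) \<in> R \<longrightarrow> (a + c, b + d) \<in> R \<and> (a * c, b * d) \<in> R)"

definition zero_class :: "('a :: b1_algebra \<times> 'a) set \<Rightarrow> 'a set" where
  "zero_class R = {x. (x, 0) \<in> R}"

definition saturated_ideal :: "'a :: b1_algebra set \<Rightarrow> bool" where
  "saturated_ideal J \<longleftrightarrow> b1_ideal J \<and> (\<exists>R. b1_congruence R \<and> J = zero_class R)"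

definition Pr :: "'a :: b1_algebra set set" where
  "Pr = {P. b1_prime_ideal P}"

definition Pr_s :: "'a :: b1_algebra set set" where
  "Pr_s = {P \<in> Pr. saturated_ideal P}"

definition W_of :: "'a :: b1_algebra set \<Rightarrow> 'a set set" where
  "W_of S = {P \<in> Pr. S \<subseteq> P}"

definition Pr_topology :: "'a :: b1_algebra set topology" where
  "Pr_topology = topology (\<lambda>U. \<exists>S. U = Pr - W_of S)"

definition Pr_s_topology :: "'a :: b1_algebra set topology" where
  "Pr_s_topology = subtopology Pr_topology Pr_s"

definition D_of :: "'a :: b1_algebra \<Rightarrow> 'a set set" where
  "D_of f = {P \<in> Pr_s. f \<notin> P}"

text \<open>The analogue of \<^const>\<open>topological_basis\<close> for abstract topologies.\<close>
definition open_basis_in :: "'a topology \<Rightarrow> 'a set set \<Rightarrow> bool" where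
  "open_basis_in X \<B> \<longleftrightarrow>
     (\<forall>B\<in>\<B>. openin X B) \<and> (\<forall>U. openin X U \<longrightarrow> (\<exists>\<C>\<subseteq>\<B>. \<Union>\<C> = U))"

definition irreducible_closedin :: "'a topology \<Rightarrow> 'a set \<Rightarrow> bool" where
  "irreducible_closedin X F \<longleftrightarrow> closedin X F \<and> F \<noteq> {} \<and>
     (\<forall>G H. closedin X G \<longrightarrow> closedin X H \<longrightarrow> F = G \<union> H \<longrightarrow> F = G \<or> F = H)"

definition generic_point_in :: "'a topology \<Rightarrow> 'a set \<Rightarrow> 'a \<Rightarrow> bool" where
  "generic_point_in X F p \<longleftrightarrow> p \<in> topspace X \<and> X closure_of {p} = F"

text \<open>The constant \<^const>\<open>topology\<close> is only meaningful on families that really form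
  a topology; the following facts discharge this for \<^const>\<open>Pr_topology\<close>.\<close>

lemma W_of_Int:
  "(Pr - W_of S) \<inter> (Pr - W_of T) = Pr - W_of {s * t | s t. s \<in> S \<and> t \<in> T}"
proof -
  have "{s * t | s t. s \<in> S \<and> t \<in> T} \<subseteq> P \<longleftrightarrow> S \<subseteq> P \<or> T \<subseteq> P" if "P \<in> Pr" for P
  proof
    assume sub: "{s * t | s t. s \<in> S \<and> t \<in> T} \<subseteq> P"
    show "S \<subseteq> P \<or> T \<subseteq> P"
    proof (rule ccontr)
      assume "\<not> (S \<subseteq> P \<or> T \<subseteq> P)"
      then obtain s t where "s \<in> S" "s \<notin> P" "t \<in> T" "t \<notin> P" by blast
      moreover from this have "s * t \<in> P" using sub by blast
      ultimately show False using that by (auto simp: Pr_def b1_prime_ideal_def)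
    qed
  next
    have mem: "a * x \<in> P" if "x \<in> P" for a x
      using that \<open>P \<in> Pr\<close> by (auto simp: Pr_def b1_prime_ideal_def b1_ideal_def)
    assume "S \<subseteq> P \<or> T \<subseteq> P"
    then show "{s * t | s t. s \<in> S \<and> t \<in> T} \<subseteq> P"
    proof
      assume "S \<subseteq> P"
      then have "s * t \<in> P" if "s \<in> S" for s t
        using mem[of s t] that by (auto simp: mult.commute[of t s])
      then show ?thesis by blast
    next
      assume "T \<subseteq> P"
      then show ?thesis using mem by auto
    qed
  qed
  then have "P \<in> W_of {s * t | s t. s \<in> S \<and> t \<in> T} \<longleftrightarrow> P \<in> W_of S \<or> P \<in> W_of T"
    if "P \<in> Pr" for P
    using that unfolding W_of_def mem_Collect_eq by blast
  then show ?thesis by blast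
qed

lemma openin_Pr_topology: "openin Pr_topology U \<longleftrightarrow> (\<exists>S. U = Pr - W_of S)"
proof -
  have "istopology (\<lambda>U :: 'a set set. \<exists>S. U = Pr - W_of S)"
    unfolding istopology_def
  proof (intro conjI allI impI)
    fix U V :: "'a set set"
    assume "\<exists>S. U = Pr - W_of S" "\<exists>S. V = Pr - W_of S"
    then obtain S T where "U = Pr - W_of S" "V = Pr - W_of T" by blast
    then show "\<exists>S. U \<inter> V = Pr - W_of S" using W_of_Int[of S T] by blast
  next
    fix \<K> :: "'a set set set"
    assume "\<forall>K\<in>\<K>. \<exists>S. K = Pr - W_of S"
    then obtain S where S: "\<forall>K\<in>\<K>. K = Pr - W_of (S K)"
      unfolding bchoice_iff by blast
    then have "\<Union>\<K> = (\<Union>K\<in>\<K>. Pr - W_of (S K))" by blast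
    also have "\<dots> = Pr - W_of (\<Union>K\<in>\<K>. S K)" by (auto simp: W_of_def)
    finally show "\<exists>S. \<Union>\<K> = Pr - W_of S" by blast
  qed
  then show ?thesis unfolding Pr_topology_def by simp
qed

lemma topspace_Pr_topology [simp]: "topspace Pr_topology = Pr"
proof -
  have "W_of {1} = ({} :: 'a set set)"
  proof -
    have "(1::'a) \<notin> P" if P: "b1_prime_ideal P" for P
    proof
      assume "1 \<in> P"
      then have "a * 1 \<in> P" for a
        using P unfolding b1_prime_ideal_def b1_ideal_def by blast
      then have "P = UNIV" by auto
      then show False using P by (simp add: b1_prime_ideal_def)
    qed
    then show ?thesis by (auto simp: W_of_def Pr_def)
  qed
  then have "Pr = Pr - W_of {1 :: 'a}" by simp
  then have "openin Pr_topology (Pr :: 'a set set)"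
    unfolding openin_Pr_topology by blast
  then show ?thesis
    by (auto simp: topspace_def openin_Pr_topology)
qed

lemma closedin_Pr_topology: "closedin Pr_topology F \<longleftrightarrow> (\<exists>S. F = W_of S)"
proof
  assume F: "closedin Pr_topology F"
  then obtain S where "Pr - F = Pr - W_of S"
    unfolding closedin_def openin_Pr_topology by auto
  moreover have "F \<subseteq> Pr" using closedin_subset[OF F] by simp
  moreover have "W_of S \<subseteq> Pr" by (auto simp: W_of_def)
  ultimately show "\<exists>S. F = W_of S" by blast
next
  assume "\<exists>S. F = W_of S"
  then show "closedin Pr_topology F"
    unfolding closedin_def openin_Pr_topology by (auto simp: W_of_def)
qed

lemma topspace_Pr_s_topology [simp]: "topspace Pr_s_topology = Pr_s"
  by (auto simp: Pr_s_topology_def Pr_s_def)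

end

(* Saturated ideals are the ideals that are downward closed for the order x + y = y, so
   saturation can be tested without congruences. By Zorn, an ideal maximal among the saturated
   ideals avoiding all powers of f is prime; hence f lies in every saturated prime containing S
   only if some power of f lies in the saturated ideal generated by S, and then already in the
   one generated by a finite part of S. This is quasi-compactness of D(f). The generic
   point of an irreducible closed set is the intersection of its members. *)
theory Submission
  imports Defs
begin

section \<open>Saturated ideals as lower ideals\<close>

text \<open>Write \<open>x \<le> z\<close> for \<open>x + z = z\<close>. By idempotence the elements
  above \<open>x\<close> are exactly those of the form \<open>x + y\<close>, so the second clause is
  downward closure without a separate order relation.\<close>

definition lower_ideal :: "'a :: b1_algebra set \<Rightarrow> bool" where
  "lower_ideal J \<longleftrightarrow> b1_ideal J \<and> (\<forall>x y. x + y \<in> J \<longrightarrow> x \<in> J)"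

lemma lower_idealD:
  assumes "lower_ideal J"
  shows lower_ideal_zero: "0 \<in> J"
    and lower_ideal_add: "x \<in> J \<Longrightarrow> y \<in> J \<Longrightarrow> x + y \<in> J"
    and lower_ideal_mult: "x \<in> J \<Longrightarrow> a * x \<in> J"
    and lower_ideal_mult_right: "x \<in> J \<Longrightarrow> x * a \<in> J"
    and lower_ideal_lower: "x + y \<in> J \<Longrightarrow> x \<in> J"
proof -
  show "0 \<in> J" "x \<in> J \<Longrightarrow> y \<in> J \<Longrightarrow> x + y \<in> J" "x + y \<in> J \<Longrightarrow> x \<in> J"
    using assms unfolding lower_ideal_def b1_ideal_def by blast+
  have mult: "x \<in> J \<Longrightarrow> a * x \<in> J"
    using assms unfolding lower_ideal_def b1_ideal_def by blast
  then show "x \<in> J \<Longrightarrow> a * x \<in> J" .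
  show "x \<in> J \<Longrightarrow> x * a \<in> J"
    using mult by (simp only: mult.commute)
qed

text \<open>If \<open>x + y\<close> is congruent to 0, adding \<open>x\<close> on both sides shows
  that \<open>x + y\<close> is also congruent to \<open>x\<close>, so \<open>x\<close> is congruent
  to 0. Conversely, a lower ideal \<open>J\<close> is the zero class of the congruence that equates
  elements agreeing after addition of some \<open>j\<close> in \<open>J\<close>.\<close>

lemma saturated_ideal_iff_lower: "saturated_ideal J \<longleftrightarrow> lower_ideal J"
proof
  assume "saturated_ideal J"
  then obtain R where I: "b1_ideal J" and R: "b1_congruence R" and J: "J = zero_class R"
    unfolding saturated_ideal_def by blast
  have eq: "equiv UNIV R" using R by (simp add: b1_congruence_def)
  have "x \<in> J" if "x + y \<in> J" for x y
  proof -
    have 1: "(x + y, 0) \<in> R" using that J by (simp add: zero_class_def)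
    have "(x, x) \<in> R" using eq by (simp add: equiv_def refl_on_def)
    with 1 have "(x + (x + y), x + 0) \<in> R" using R unfolding b1_congruence_def by blast
    moreover have "x + (x + y) = x + y" by (simp add: b1_add_idem flip: add.assoc)
    ultimately have "(x + y, x) \<in> R" by simp
    with 1 eq have "(x, 0) \<in> R" by (meson equivE symD transD)
    then show ?thesis using J by (simp add: zero_class_def)
  qed
  with I show "lower_ideal J" by (auto simp: lower_ideal_def)
next
  assume J: "lower_ideal J"
  \<comment> \<open>By idempotence this is the Bourne congruence \<open>x + i = y + j\<close> with
    \<open>i\<close> and \<open>j\<close> in \<open>J\<close>: adding \<open>i + j\<close> to both
    sides makes the two summands equal. A single \<open>j\<close> makes symmetry immediate.\<close>
  define R where "R = {(x, y). \<exists>j\<in>J. x + j = y + j}"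
  have "equiv UNIV R"
  proof (rule equivI)
    show "refl R"
      using lower_ideal_zero[OF J] by (auto simp: refl_on_def R_def)
    show "sym R" unfolding sym_def R_def mem_Collect_eq case_prod_conv by metis
    show "trans R"
    proof (rule transI)
      fix x y z assume "(x, y) \<in> R" "(y, z) \<in> R"
      then obtain j k where "j \<in> J" "k \<in> J" and jk: "x + j = y + j" "y + k = z + k"
        by (auto simp: R_def)
      moreover have "x + (j + k) = z + (j + k)"
      proof -
        have "x + (j + k) = (x + j) + k" by (simp add: ac_simps)
        also have "\<dots> = (y + k) + j" by (simp only: jk(1)) (simp add: ac_simps)
        also have "\<dots> = z + (j + k)" by (simp only: jk(2)) (simp add: ac_simps)
        finally show ?thesis .
      qed
      ultimately show "(x, z) \<in> R" using lower_ideal_add[OF J] by (auto simp: R_def)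
    qed
  qed simp
  moreover have "(a + c, b + d) \<in> R \<and> (a * c, b * d) \<in> R"
    if "(a, b) \<in> R" "(c, d) \<in> R" for a b c d
  proof -
    from that obtain j k where jk: "j \<in> J" "k \<in> J" "a + j = b + j" "c + k = d + k"
      by (auto simp: R_def)
    have "(a + c) + (j + k) = (a + j) + (c + k)" by (simp add: ac_simps)
    also have "\<dots> = (b + d) + (j + k)" by (simp only: jk) (simp add: ac_simps)
    finally have sum: "(a + c, b + d) \<in> R" using lower_ideal_add[OF J jk(1,2)] by (auto simp: R_def)
    \<comment> \<open>Pass from \<open>a * c\<close> to \<open>b * c\<close> to
      \<open>b * d\<close>: the summand \<open>c * j\<close> pays for replacing \<open>a\<close> by
      \<open>b\<close>, and \<open>b * k\<close> for replacing \<open>c\<close> by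
      \<open>d\<close>.\<close>
    let ?e = "c * j + b * k"
    have "a * c + ?e = (a + j) * c + b * k" by (simp add: algebra_simps)
    also have "\<dots> = j * c + b * (c + k)" by (simp only: jk(3)) (simp add: algebra_simps)
    also have "\<dots> = b * d + ?e" by (simp only: jk(4)) (simp add: algebra_simps)
    finally have "(a * c, b * d) \<in> R"
      using lower_ideal_add[OF J] lower_ideal_mult[OF J] jk(1,2) unfolding R_def by blast
    with sum show ?thesis ..
  qed
  ultimately have "b1_congruence R" unfolding b1_congruence_def by blast
  moreover have "J = zero_class R"
  proof
    \<comment> \<open>For \<open>x\<close> in \<open>J\<close> the witness is \<open>x\<close>
      itself, as \<open>x + x = 0 + x\<close>. In the other direction \<open>x + j = j\<close> puts
      \<open>x\<close> below an element of \<open>J\<close>.\<close>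
    show "J \<subseteq> zero_class R"
      using b1_add_idem by (fastforce simp: zero_class_def R_def)
    show "zero_class R \<subseteq> J"
      using lower_ideal_lower[OF J] unfolding zero_class_def R_def
      by clarsimp metis
  qed
  ultimately show "saturated_ideal J"
    using J by (auto simp: saturated_ideal_def lower_ideal_def)
qed

lemma Pr_s_iff:
  "P \<in> Pr_s \<longleftrightarrow> lower_ideal P \<and> P \<noteq> UNIV \<and> (\<forall>a b. a * b \<in> P \<longrightarrow> a \<in> P \<or> b \<in> P)"
  by (auto simp: Pr_s_def Pr_def b1_prime_ideal_def saturated_ideal_iff_lower lower_ideal_def)

lemma Pr_s_imp_lower_ideal: "P \<in> Pr_s \<Longrightarrow> lower_ideal P"
  by (simp add: Pr_s_iff)

lemma Pr_s_mult_iff: "P \<in> Pr_s \<Longrightarrow> a * b \<in> P \<longleftrightarrow> a \<in> P \<or> b \<in> P"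
  by (meson Pr_s_iff lower_ideal_mult lower_ideal_mult_right)

lemma one_notin_Pr_s:
  assumes "P \<in> Pr_s" shows "1 \<notin> P"
proof
  assume "1 \<in> P"
  then have "x * 1 \<in> P" for x
    using assms Pr_s_imp_lower_ideal lower_ideal_mult by blast
  then have "P = UNIV" by auto
  then show False using assms by (simp add: Pr_s_iff)
qed

section \<open>Intersections, directed unions and extensions of lower ideals\<close>

lemma lower_ideal_Inter: "(\<And>J. J \<in> \<J> \<Longrightarrow> lower_ideal J) \<Longrightarrow> lower_ideal (\<Inter>\<J>)"
  unfolding lower_ideal_def b1_ideal_def by blast

text \<open>Only the sum involves two elements, and directedness places both in one member. This
  serves both the chains in Zorn's lemma and the hulls of finite subsets.\<close>

lemma lower_ideal_Union_directed:
  assumes ne: "\<J> \<noteq> {}" and lower: "\<And>J. J \<in> \<J> \<Longrightarrow> lower_ideal J"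
    and dir: "\<And>J K. J \<in> \<J> \<Longrightarrow> K \<in> \<J> \<Longrightarrow> \<exists>L\<in>\<J>. J \<subseteq> L \<and> K \<subseteq> L"
  shows "lower_ideal (\<Union>\<J>)"
  unfolding lower_ideal_def b1_ideal_def
proof (intro conjI ballI allI impI)
  show "0 \<in> \<Union>\<J>" using ne lower lower_ideal_zero by blast
next
  fix x y assume "x \<in> \<Union>\<J>" "y \<in> \<Union>\<J>"
  then obtain L where "L \<in> \<J>" "x \<in> L" "y \<in> L" using dir by blast
  then show "x + y \<in> \<Union>\<J>" using lower lower_ideal_add by blast
next
  fix a x assume "x \<in> \<Union>\<J>"
  then show "a * x \<in> \<Union>\<J>" using lower lower_ideal_mult by blast
next
  fix x y assume "x + y \<in> \<Union>\<J>"
  then show "x \<in> \<Union>\<J>" using lower lower_ideal_lower by blast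
qed

lemma lower_ideal_hull: "lower_ideal (lower_ideal hull S)"
  by (rule hull_in) (simp add: lower_ideal_Inter)

text \<open>The set consists of the elements below some \<open>m + c * a\<close>; it is the lower
  ideal generated by \<open>M\<close> and \<open>a\<close>.\<close>

lemma lower_ideal_extend:
  assumes M: "lower_ideal M"
  shows "lower_ideal {x. \<exists>m\<in>M. \<exists>c. x + (m + c * a) = m + c * a}" (is "lower_ideal ?K")
    and "insert a M \<subseteq> {x. \<exists>m\<in>M. \<exists>c. x + (m + c * a) = m + c * a}"
proof -
  have "x + y \<in> ?K" if xy: "x \<in> ?K" "y \<in> ?K" for x y
  proof -
    from xy obtain m c n d where mn: "m \<in> M" "n \<in> M"
      and eqs: "x + (m + c * a) = m + c * a" "y + (n + d * a) = n + d * a" by blast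
    have "(x + y) + ((m + n) + (c + d) * a) = (x + (m + c * a)) + (y + (n + d * a))"
      by (simp add: algebra_simps)
    also have "\<dots> = (m + n) + (c + d) * a" by (simp only: eqs) (simp add: algebra_simps)
    finally show ?thesis using lower_ideal_add[OF M mn] by blast
  qed
  moreover have "b * x \<in> ?K" if x: "x \<in> ?K" for b x
  proof -
    from x obtain m c where m: "m \<in> M" and eq: "x + (m + c * a) = m + c * a" by blast
    have "b * x + (b * m + (b * c) * a) = b * (x + (m + c * a))"
      by (simp add: algebra_simps)
    also have "\<dots> = b * m + (b * c) * a" by (simp only: eq) (simp add: algebra_simps)
    finally show ?thesis using lower_ideal_mult[OF M m] by blast
  qed
  moreover have "x \<in> ?K" if xy: "x + y \<in> ?K" for x y
  proof -
    from xy obtain m c where m: "m \<in> M" and eq: "x + y + (m + c * a) = m + c * a" by blast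
    have "x + (m + c * a) = x + (x + y + (m + c * a))" by (simp only: eq)
    also have "\<dots> = x + y + (m + c * a)"
      by (simp add: b1_add_idem flip: add.assoc)
    finally show ?thesis using m eq by auto
  qed
  moreover have "0 \<in> ?K" using lower_ideal_zero[OF M] by auto
  ultimately show "lower_ideal ?K" unfolding lower_ideal_def b1_ideal_def by blast
  have "a + (0 + 1 * a) = 0 + 1 * a" by (simp add: b1_add_idem)
  then have "a \<in> ?K" using lower_ideal_zero[OF M] by blast
  moreover have "m \<in> ?K" if "m \<in> M" for m
  proof -
    have "m + (m + 0 * a) = m + 0 * a" by (simp add: b1_add_idem)
    then show ?thesis using that by blast
  qed
  ultimately show "insert a M \<subseteq> ?K" by blast
qed

section \<open>Separation by saturated primes\<close>

text \<open>Multiplication is monotone: \<open>x * y\<close> is one of the four terms of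
  \<open>(x + u) * (y + v)\<close>, so idempotence absorbs it.\<close>

lemma b1_mult_mono:
  fixes x y u v :: "'a :: b1_algebra"
  assumes "x + u = u" "y + v = v"
  shows "x * y + u * v = u * v"
proof -
  have "x * y + (x + u) * (y + v) = (x * y + x * y) + (x * v + u * y + u * v)"
    by (simp add: algebra_simps)
  also have "\<dots> = (x + u) * (y + v)"
    by (simp only: b1_add_idem) (simp add: algebra_simps)
  finally show ?thesis by (simp only: assms)
qed

text \<open>If \<open>a\<close> and \<open>b\<close> were both outside \<open>M\<close>, the
  extensions of \<open>M\<close> by each would meet \<open>T\<close>, in some \<open>s\<close> below
  \<open>m + c * a\<close> and \<open>t\<close> below \<open>n + d * b\<close>. Then
  \<open>s * t\<close> lies below the product of these bounds. All its terms lie in \<open>M\<close>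
  because \<open>a * b\<close> does, so \<open>s * t\<close> lies in \<open>M\<close> and in
  \<open>T\<close>, a contradiction.\<close>

lemma maximal_avoiding_imp_prime:
  assumes M: "lower_ideal M" and T1: "1 \<in> T" and Tmult: "\<And>s t. s \<in> T \<Longrightarrow> t \<in> T \<Longrightarrow> s * t \<in> T"
    and disj: "M \<inter> T = {}"
    and max: "\<And>K. lower_ideal K \<Longrightarrow> M \<subseteq> K \<Longrightarrow> K \<inter> T = {} \<Longrightarrow> K = M"
  shows "M \<in> Pr_s"
  unfolding Pr_s_iff
proof (intro conjI allI impI)
  show "M \<noteq> UNIV" using T1 disj by blast
next
  fix a b assume ab: "a * b \<in> M"
  \<comment> \<open>The extension of \<open>M\<close> by \<open>e\<close> is strictly larger than
    \<open>M\<close>, so by maximality it meets \<open>T\<close>.\<close>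
  have bound: "\<exists>t\<in>T. \<exists>m\<in>M. \<exists>c. t + (m + c * e) = m + c * e" if "e \<notin> M" for e
    using max[OF lower_ideal_extend(1)[OF M, of e]] lower_ideal_extend(2)[OF M, of e] that
    by blast
  show "a \<in> M \<or> b \<in> M"
  proof (rule ccontr)
    assume "\<not> (a \<in> M \<or> b \<in> M)"
    then obtain s m c t n d where T: "s \<in> T" "t \<in> T" and mn: "m \<in> M" "n \<in> M"
      and eqs: "s + (m + c * a) = m + c * a" "t + (n + d * b) = n + d * b"
      using bound by meson
    have "(m + c * a) * (n + d * b) = m * (n + d * b) + ((c * a) * n + (c * d) * (a * b))"
      by (simp add: algebra_simps)
    also have "\<dots> \<in> M"
      by (intro lower_ideal_add[OF M] lower_ideal_mult[OF M ab] lower_ideal_mult[OF M mn(2)]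
          lower_ideal_mult_right[OF M mn(1)])
    finally have "s * t + (m + c * a) * (n + d * b) \<in> M" by (simp only: b1_mult_mono[OF eqs])
    then have "s * t \<in> M" by (rule lower_ideal_lower[OF M])
    then show False using Tmult[OF T] disj by blast
  qed
qed (rule M)

text \<open>The analogue of Krull's separation lemma: Zorn's lemma gives a maximal lower ideal
  containing \<open>J\<close> and disjoint from the multiplicative set \<open>T\<close>, and such an
  ideal is prime.\<close>

lemma Pr_s_avoiding_exists:
  assumes J: "lower_ideal J" and T1: "1 \<in> T"
    and Tmult: "\<And>s t. s \<in> T \<Longrightarrow> t \<in> T \<Longrightarrow> s * t \<in> T" and disj: "J \<inter> T = {}"
  obtains P where "P \<in> Pr_s" "J \<subseteq> P" "P \<inter> T = {}"
proof -
  let ?\<A> = "{K. lower_ideal K \<and> J \<subseteq> K \<and> K \<inter> T = {}}"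
  have "\<exists>M\<in>?\<A>. \<forall>X\<in>?\<A>. M \<subseteq> X \<longrightarrow> X = M"
  proof (rule subset_Zorn_nonempty)
    show "?\<A> \<noteq> {}" using J disj by blast
  next
    fix \<C> assume ne: "\<C> \<noteq> {}" and chain: "subset.chain ?\<A> \<C>"
    have \<C>: "\<C> \<subseteq> ?\<A>" and total: "\<And>X Y. X \<in> \<C> \<Longrightarrow> Y \<in> \<C> \<Longrightarrow> X \<subseteq> Y \<or> Y \<subseteq> X"
      using chain unfolding subset_chain_def by blast+
    have "lower_ideal (\<Union>\<C>)"
    proof (rule lower_ideal_Union_directed[OF ne])
      show "lower_ideal X" if "X \<in> \<C>" for X using that \<C> by blast
      show "\<exists>Z\<in>\<C>. X \<subseteq> Z \<and> Y \<subseteq> Z" if "X \<in> \<C>" "Y \<in> \<C>" for X Y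
        using total[OF that] that by (metis subset_refl)
    qed
    moreover have "J \<subseteq> \<Union>\<C>" "\<Union>\<C> \<inter> T = {}" using ne \<C> by blast+
    ultimately show "\<Union>\<C> \<in> ?\<A>" by simp
  qed
  then obtain M where M: "M \<in> ?\<A>" and max: "\<forall>X\<in>?\<A>. M \<subseteq> X \<longrightarrow> X = M" by (rule bexE)
  have "M \<in> Pr_s"
  proof (rule maximal_avoiding_imp_prime[OF _ T1 Tmult])
    show "lower_ideal M" "M \<inter> T = {}" using M by blast+
    show "K = M" if "lower_ideal K" "M \<subseteq> K" "K \<inter> T = {}" for K
      using that M by (intro max[rule_format]) auto
  qed
  then show ?thesis using that M by blast
qed

text \<open>Were no power of \<open>f\<close> in the lower ideal generated by \<open>S\<close>,
  separation would give a saturated prime containing \<open>S\<close> but not \<open>f\<close>. A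
  power in that ideal already lies in the one generated by a finite part of
  \<open>S\<close>.\<close>

lemma Pr_s_Nullstellensatz_finite:
  assumes f: "\<And>P. P \<in> Pr_s \<Longrightarrow> S \<subseteq> P \<Longrightarrow> f \<in> P"
  obtains T where "finite T" "T \<subseteq> S" "\<And>P. P \<in> Pr_s \<Longrightarrow> T \<subseteq> P \<Longrightarrow> f \<in> P"
proof -
  \<comment> \<open>This is the lower ideal generated by \<open>S\<close>, written as a directed
    union so that membership in it directly yields a finite subset.\<close>
  define J where "J = \<Union>((hull) lower_ideal ` {T. finite T \<and> T \<subseteq> S})"
  have "lower_ideal J"
    unfolding J_def
  proof (rule lower_ideal_Union_directed)
    show "(hull) lower_ideal ` {T. finite T \<and> T \<subseteq> S} \<noteq> {}" by blast
  next
    fix K L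
    assume "K \<in> (hull) lower_ideal ` {T. finite T \<and> T \<subseteq> S}"
      "L \<in> (hull) lower_ideal ` {T. finite T \<and> T \<subseteq> S}"
    then obtain T U where "finite T" "T \<subseteq> S" "finite U" "U \<subseteq> S"
      "K = lower_ideal hull T" "L = lower_ideal hull U" by blast
    moreover from this have "K \<subseteq> lower_ideal hull (T \<union> U)" "L \<subseteq> lower_ideal hull (T \<union> U)"
      by (simp_all add: hull_mono)
    ultimately show "\<exists>L'\<in>(hull) lower_ideal ` {T. finite T \<and> T \<subseteq> S}. K \<subseteq> L' \<and> L \<subseteq> L'"
      by (intro bexI[of _ "lower_ideal hull (T \<union> U)"]) auto
  qed (auto simp: lower_ideal_hull)
  moreover have "S \<subseteq> J"
  proof
    fix s assume "s \<in> S"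
    moreover have "s \<in> lower_ideal hull {s}" by (simp add: hull_inc)
    ultimately show "s \<in> J" unfolding J_def by blast
  qed
  moreover have "range ((^) f) \<inter> J \<noteq> {}"
  proof
    assume "range ((^) f) \<inter> J = {}"
    moreover have "1 \<in> range ((^) f)" by (metis power_0 rangeI)
    moreover have "s * t \<in> range ((^) f)" if "s \<in> range ((^) f)" "t \<in> range ((^) f)" for s t
      using that by (auto simp flip: power_add)
    ultimately obtain P where P: "P \<in> Pr_s" "J \<subseteq> P" "P \<inter> range ((^) f) = {}"
      using Pr_s_avoiding_exists[OF \<open>lower_ideal J\<close>, of "range ((^) f)"] by blast
    moreover have "f \<in> range ((^) f)" by (metis power_one_right rangeI)
    ultimately show False using f[of P] \<open>S \<subseteq> J\<close> by blast
  qed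
  ultimately obtain n where "f ^ n \<in> J" by auto
  then obtain T where T: "finite T" "T \<subseteq> S" and n: "f ^ n \<in> lower_ideal hull T"
    by (auto simp: J_def)
  have "f \<in> P" if P: "P \<in> Pr_s" and "T \<subseteq> P" for P
  proof -
    have "f ^ n \<in> P"
      using n hull_minimal[of T P lower_ideal] that Pr_s_imp_lower_ideal by blast
    \<comment> \<open>Exponent 0 is excluded because 1 lies in no prime; otherwise primality strips
      off factors of \<open>f\<close>.\<close>
    then show "f \<in> P"
      by (induction n) (use P in \<open>auto simp: Pr_s_mult_iff one_notin_Pr_s\<close>)
  qed
  with T show ?thesis using that by blast
qed

section \<open>Open sets and quasi-compactness\<close>

lemma D_of_subset: "D_of f \<subseteq> Pr_s"
  by (auto simp: D_of_def)

lemma Pr_s_minus_W_of: "Pr_s - W_of S = (\<Union>f\<in>S. D_of f)"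
  by (auto simp: W_of_def D_of_def Pr_s_def)

lemma openin_Pr_s_topology: "openin Pr_s_topology U \<longleftrightarrow> (\<exists>S. U = (\<Union>f\<in>S. D_of f))"
proof -
  have "(Pr - W_of S) \<inter> Pr_s = Pr_s - W_of S" for S :: "'a set"
    by (auto simp: Pr_s_def)
  then show ?thesis
    unfolding Pr_s_topology_def openin_subtopology openin_Pr_topology Pr_s_minus_W_of[symmetric]
    by metis
qed

lemma closedin_Pr_s_topology: "closedin Pr_s_topology F \<longleftrightarrow> (\<exists>S. F = {P \<in> Pr_s. S \<subseteq> P})"
proof -
  have "(F \<subseteq> Pr_s \<and> Pr_s - F = (\<Union>f\<in>S. D_of f)) \<longleftrightarrow> F = {P \<in> Pr_s. S \<subseteq> P}" for S
    by (auto simp: D_of_def)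
  then show ?thesis
    unfolding closedin_def openin_Pr_s_topology topspace_Pr_s_topology by metis
qed

lemma openin_D_of: "openin Pr_s_topology (D_of f)"
  unfolding openin_Pr_s_topology by (rule exI[of _ "{f}"]) simp

text \<open>Write each member \<open>U\<close> of a cover as the union of \<open>D_of g\<close> over
  \<open>g\<close> in \<open>S U\<close>. Covering \<open>D_of f\<close> means that a saturated
  prime containing every \<open>S U\<close> contains \<open>f\<close>. Finitely many of these
  \<open>g\<close> already force this, and one member of the cover is chosen for each.\<close>

lemma compactin_D_of: "compactin Pr_s_topology (D_of f)"
  unfolding compactin_def
proof (intro conjI allI impI)
  fix \<U> assume \<U>: "Ball \<U> (openin Pr_s_topology) \<and> D_of f \<subseteq> \<Union>\<U>"
  then obtain S where S: "\<And>U. U \<in> \<U> \<Longrightarrow> U = (\<Union>g\<in>S U. D_of g)"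
    unfolding openin_Pr_s_topology by metis
  have "f \<in> P" if "P \<in> Pr_s" and sub: "(\<Union>U\<in>\<U>. S U) \<subseteq> P" for P
  proof (rule ccontr)
    assume "f \<notin> P"
    with that(1) have "P \<in> D_of f" by (simp add: D_of_def)
    then obtain U where "U \<in> \<U>" "P \<in> U" using \<U> by blast
    then obtain g where "g \<in> S U" "P \<in> D_of g" using S by blast
    then show False using sub \<open>U \<in> \<U>\<close> by (auto simp: D_of_def)
  qed
  then obtain T where T: "finite T" "T \<subseteq> (\<Union>U\<in>\<U>. S U)"
    and fT: "\<And>P. P \<in> Pr_s \<Longrightarrow> T \<subseteq> P \<Longrightarrow> f \<in> P"
    using Pr_s_Nullstellensatz_finite[of "\<Union>U\<in>\<U>. S U" f] by blast
  have "\<forall>t\<in>T. \<exists>U. U \<in> \<U> \<and> t \<in> S U" using T by blast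
  then obtain u where u: "\<And>t. t \<in> T \<Longrightarrow> u t \<in> \<U> \<and> t \<in> S (u t)" by metis
  define \<F> where "\<F> = u ` T"
  have \<F>: "finite \<F>" "\<F> \<subseteq> \<U>" "T \<subseteq> (\<Union>U\<in>\<F>. S U)"
    using T u by (auto simp: \<F>_def)
  have "D_of f \<subseteq> \<Union>\<F>"
  proof
    fix P assume P: "P \<in> D_of f"
    then have "P \<in> Pr_s" "f \<notin> P" by (auto simp: D_of_def)
    then obtain t where "t \<in> T" "t \<notin> P" using fT by blast
    then obtain U where "U \<in> \<F>" "t \<in> S U" using \<F> by blast
    moreover have "P \<in> D_of t" using \<open>P \<in> Pr_s\<close> \<open>t \<notin> P\<close> by (simp add: D_of_def)
    ultimately show "P \<in> \<Union>\<F>" using S[of U] \<F>(2) by blast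
  qed
  then show "\<exists>\<F>. finite \<F> \<and> \<F> \<subseteq> \<U> \<and> D_of f \<subseteq> \<Union>\<F>" using \<F> by blast
qed (simp add: D_of_subset)

text \<open>An open set is covered by the sets \<open>D_of f\<close> it is a union of, and
  quasi-compactness keeps finitely many. Conversely, a finite union of quasi-compact sets is
  quasi-compact.\<close>

lemma open_compact_Pr_s_iff:
  "openin Pr_s_topology U \<and> compactin Pr_s_topology U \<longleftrightarrow>
    (\<exists>S. finite S \<and> U = (\<Union>f\<in>S. D_of f))"
proof
  assume U: "openin Pr_s_topology U \<and> compactin Pr_s_topology U"
  then obtain S where S: "U = (\<Union>f\<in>S. D_of f)" by (auto simp: openin_Pr_s_topology)
  then obtain \<F> where "finite \<F>" "\<F> \<subseteq> D_of ` S" "U \<subseteq> \<Union>\<F>"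
    using U compactinD[of Pr_s_topology U "D_of ` S"] openin_D_of by blast
  moreover from this obtain T where T: "finite T" "T \<subseteq> S" "\<F> = D_of ` T"
    by (meson finite_subset_image)
  ultimately have "U = (\<Union>f\<in>T. D_of f)" using S by auto
  with T(1) show "\<exists>S. finite S \<and> U = (\<Union>f\<in>S. D_of f)" by (intro exI[of _ T] conjI)
next
  assume "\<exists>S. finite S \<and> U = (\<Union>f\<in>S. D_of f)"
  then obtain S where "finite S" and U: "U = \<Union>(D_of ` S)" by blast
  have "compactin Pr_s_topology U"
    unfolding U by (rule compactin_Union) (use \<open>finite S\<close> compactin_D_of in auto)
  moreover have "openin Pr_s_topology U"
    unfolding openin_Pr_s_topology using U by (rule exI)
  ultimately show "openin Pr_s_topology U \<and> compactin Pr_s_topology U" by blast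
qed

lemma open_basis_in_D_of: "open_basis_in Pr_s_topology (range D_of)"
  unfolding open_basis_in_def
proof (intro conjI ballI allI impI)
  show "openin Pr_s_topology B" if "B \<in> range D_of" for B
    using that openin_D_of by auto
  show "\<exists>\<C>\<subseteq>range D_of. \<Union>\<C> = U" if "openin Pr_s_topology U" for U
  proof -
    from that obtain S where "U = \<Union>(D_of ` S)" by (auto simp: openin_Pr_s_topology)
    then show ?thesis by (intro exI[of _ "D_of ` S"]) auto
  qed
qed

text \<open>A prime is an ideal, so containing \<open>S\<close> and containing the ideal it
  generates are the same. This turns finite sets of generators into ideals of finite type.\<close>

lemma W_of_ideal_generated_by: "W_of (ideal_generated_by S) = W_of S"
proof -
  have "ideal_generated_by S \<subseteq> P \<longleftrightarrow> S \<subseteq> P" if "P \<in> Pr" for P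
  proof
    show "S \<subseteq> P" if "ideal_generated_by S \<subseteq> P"
      using that hull_subset[of S b1_ideal] by (auto simp: ideal_generated_by_def)
    show "ideal_generated_by S \<subseteq> P" if "S \<subseteq> P"
      unfolding ideal_generated_by_def
      by (rule hull_minimal) (use that \<open>P \<in> Pr\<close> in \<open>auto simp: Pr_def b1_prime_ideal_def\<close>)
  qed
  then show ?thesis by (auto simp: W_of_def)
qed

lemma D_of_Int: "D_of f \<inter> D_of g = D_of (f * g)"
  by (auto simp: D_of_def Pr_s_mult_iff)

lemma D_of_1: "D_of 1 = Pr_s"
  by (auto simp: D_of_def one_notin_Pr_s)

text \<open>Distribute the intersection over the two finite unions; primality turns each
  \<open>D_of f \<inter> D_of g\<close> into \<open>D_of (f * g)\<close>.\<close>

lemma open_compact_Pr_s_Int: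
  assumes "openin Pr_s_topology U \<and> compactin Pr_s_topology U"
    "openin Pr_s_topology V \<and> compactin Pr_s_topology V"
  shows "openin Pr_s_topology (U \<inter> V) \<and> compactin Pr_s_topology (U \<inter> V)"
proof -
  obtain S T where "finite S" "U = (\<Union>f\<in>S. D_of f)" "finite T" "V = (\<Union>f\<in>T. D_of f)"
    using assms unfolding open_compact_Pr_s_iff by blast
  moreover define H where "H = (\<lambda>(f, g). f * g) ` (S \<times> T)"
  moreover have "(\<Union>f\<in>S. D_of f) \<inter> (\<Union>f\<in>T. D_of f) = (\<Union>h\<in>H. D_of h)"
    by (simp add: H_def case_prod_beta flip: D_of_Int) auto
  ultimately have "finite H" "U \<inter> V = (\<Union>h\<in>H. D_of h)" by simp_all
  then show ?thesis unfolding open_compact_Pr_s_iff by (intro exI[of _ H] conjI)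
qed

text \<open>Intersecting with \<open>Pr_s\<close> gives the empty family its proper value, the whole
  space, which is \<open>D_of 1\<close> and therefore quasi-compact.\<close>

lemma open_compact_Pr_s_Inter:
  assumes "finite \<U>" "\<And>U. U \<in> \<U> \<Longrightarrow> openin Pr_s_topology U \<and> compactin Pr_s_topology U"
  shows "openin Pr_s_topology (Pr_s \<inter> \<Inter>\<U>) \<and> compactin Pr_s_topology (Pr_s \<inter> \<Inter>\<U>)"
  using assms
proof (induction \<U>)
  case empty
  show ?case using openin_D_of[of 1] compactin_D_of[of 1] by (simp add: D_of_1)
next
  case (insert U \<U>)
  have "openin Pr_s_topology (U \<inter> (Pr_s \<inter> \<Inter>\<U>)) \<and>
      compactin Pr_s_topology (U \<inter> (Pr_s \<inter> \<Inter>\<U>))"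
  proof (rule open_compact_Pr_s_Int)
    show "openin Pr_s_topology U \<and> compactin Pr_s_topology U"
      by (rule insert.prems) simp
    show "openin Pr_s_topology (Pr_s \<inter> \<Inter>\<U>) \<and> compactin Pr_s_topology (Pr_s \<inter> \<Inter>\<U>)"
      by (rule insert.IH) (rule insert.prems, simp)
  qed
  then show ?case by (simp add: Int_left_commute)
qed

section \<open>Irreducible closed sets and generic points\<close>

lemma closure_of_singleton_Pr_s:
  assumes "P \<in> Pr_s" shows "Pr_s_topology closure_of {P} = {Q \<in> Pr_s. P \<subseteq> Q}"
proof (rule closure_of_unique)
  show "closedin Pr_s_topology {Q \<in> Pr_s. P \<subseteq> Q}" by (auto simp: closedin_Pr_s_topology)
  show "{P} \<subseteq> {Q \<in> Pr_s. P \<subseteq> Q}" using assms by simp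
  fix F assume "{P} \<subseteq> F" "closedin Pr_s_topology F"
  then show "{Q \<in> Pr_s. P \<subseteq> Q} \<subseteq> F" by (auto simp: closedin_Pr_s_topology)
qed

text \<open>Irreducibility gives primality: if \<open>a * b\<close> lies in every member of
  \<open>F\<close>, then each member contains \<open>a\<close> or \<open>b\<close>, so
  \<open>F\<close> is the union of two closed subsets and equals one of them.\<close>

lemma Inter_irreducible_in_Pr_s:
  assumes "irreducible_closedin Pr_s_topology F"
  shows "\<Inter>F \<in> Pr_s"
proof -
  obtain S where S: "F = {P \<in> Pr_s. S \<subseteq> P}" and ne: "F \<noteq> {}"
    using assms by (auto simp: irreducible_closedin_def closedin_Pr_s_topology)
  have FP: "F \<subseteq> Pr_s" using S by blast
  show ?thesis
    unfolding Pr_s_iff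
  proof (intro conjI allI impI)
    show "lower_ideal (\<Inter>F)" by (rule lower_ideal_Inter) (use FP Pr_s_imp_lower_ideal in blast)
    show "\<Inter>F \<noteq> UNIV" using ne FP one_notin_Pr_s by blast
    fix a b assume ab: "a * b \<in> \<Inter>F"
    \<comment> \<open>Keeping \<open>S\<close> in the condition makes this the part of
      \<open>F\<close> whose members contain \<open>c\<close>.\<close>
    let ?V = "\<lambda>c. {P \<in> Pr_s. insert c S \<subseteq> P}"
    have "F = ?V a \<union> ?V b"
      using ab S by (auto simp: Pr_s_mult_iff)
    moreover have closed: "closedin Pr_s_topology (?V c)" for c
      unfolding closedin_Pr_s_topology by blast
    ultimately have "F = ?V a \<or> F = ?V b"
      using assms closed[of a] closed[of b] unfolding irreducible_closedin_def by simp
    then show "a \<in> \<Inter>F \<or> b \<in> \<Inter>F" by blast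
  qed
qed

text \<open>A closed set consists of all saturated primes containing its intersection, so the prime
  \<open>\<Inter>F\<close> has closure \<open>F\<close>. Any generic point is the least member of
  \<open>F\<close> and hence equals \<open>\<Inter>F\<close>.\<close>

lemma irreducible_closedin_Pr_s_generic_point:
  assumes F: "irreducible_closedin Pr_s_topology F"
  shows "\<exists>!p. generic_point_in Pr_s_topology F p"
proof (rule ex1I)
  have P: "\<Inter>F \<in> Pr_s" by (rule Inter_irreducible_in_Pr_s[OF F])
  obtain S where "F = {P \<in> Pr_s. S \<subseteq> P}"
    using F by (auto simp: irreducible_closedin_def closedin_Pr_s_topology)
  then have "{Q \<in> Pr_s. \<Inter>F \<subseteq> Q} = F" by blast
  then show "generic_point_in Pr_s_topology F (\<Inter>F)"
    using P by (simp add: generic_point_in_def closure_of_singleton_Pr_s)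
next
  fix p assume "generic_point_in Pr_s_topology F p"
  then have p: "p \<in> Pr_s" "F = {Q \<in> Pr_s. p \<subseteq> Q}"
    by (auto simp: generic_point_in_def closure_of_singleton_Pr_s)
  then show "p = \<Inter>F" by blast
qed

theorem proposition6p2:
  shows
    "(\<forall>f :: 'a :: b1_algebra. openin Pr_s_topology (D_of f) \<and> compactin Pr_s_topology (D_of f)) \<and>
     (open_basis_in Pr_s_topology (range (D_of :: 'a \<Rightarrow> 'a set set)) \<and>
      open_basis_in Pr_s_topology
        {U :: 'a set set. openin Pr_s_topology U \<and> compactin Pr_s_topology U}) \<and>
     (\<forall>U \<subseteq> (Pr_s :: 'a set set). openin Pr_s_topology U \<and> compactin Pr_s_topology U \<longleftrightarrow>
        (\<exists>I. finite_type_ideal I \<and> Pr_s - U = Pr_s \<inter> W_of I)) \<and>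
     (\<forall>\<U> :: 'a set set set. finite \<U> \<longrightarrow>
        (\<forall>U\<in>\<U>. openin Pr_s_topology U \<and> compactin Pr_s_topology U) \<longrightarrow>
        openin Pr_s_topology (Pr_s \<inter> \<Inter>\<U>) \<and> compactin Pr_s_topology (Pr_s \<inter> \<Inter>\<U>)) \<and>
     (\<forall>F :: 'a set set. irreducible_closedin Pr_s_topology F \<longrightarrow>
        (\<exists>!p. generic_point_in Pr_s_topology F p))"
proof (intro conjI allI impI)
  fix f :: 'a
  show "openin Pr_s_topology (D_of f)" by (rule openin_D_of)
  show "compactin Pr_s_topology (D_of f)" by (rule compactin_D_of)
next
  show "open_basis_in Pr_s_topology (range (D_of :: 'a \<Rightarrow> 'a set set))" by (rule open_basis_in_D_of)
next
  show "open_basis_in Pr_s_topology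
      {U :: 'a set set. openin Pr_s_topology U \<and> compactin Pr_s_topology U}"
    unfolding open_basis_in_def
  proof (intro conjI ballI allI impI)
    fix U :: "'a set set" assume "openin Pr_s_topology U"
    then obtain \<C> where "\<C> \<subseteq> range D_of" "\<Union>\<C> = U"
      using open_basis_in_D_of by (auto simp: open_basis_in_def)
    moreover from this have "\<C> \<subseteq> {U. openin Pr_s_topology U \<and> compactin Pr_s_topology U}"
      using openin_D_of compactin_D_of by blast
    ultimately show "\<exists>\<C>\<subseteq>{U. openin Pr_s_topology U \<and> compactin Pr_s_topology U}. \<Union>\<C> = U"
      by blast
  qed simp
next
  fix U :: "'a set set" assume "U \<subseteq> Pr_s"
  \<comment> \<open>The complement of a union of sets \<open>D_of f\<close> is cut out by the ideal
    generated by these \<open>f\<close>; as \<open>U\<close> lies in \<open>Pr_s\<close>, it is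
    recovered from its complement.\<close>
  then have eq: "U = (\<Union>f\<in>S. D_of f) \<longleftrightarrow> Pr_s - U = Pr_s \<inter> W_of (ideal_generated_by S)" for S
    unfolding W_of_ideal_generated_by Pr_s_minus_W_of[symmetric] by blast
  show "openin Pr_s_topology U \<and> compactin Pr_s_topology U \<longleftrightarrow>
      (\<exists>I. finite_type_ideal I \<and> Pr_s - U = Pr_s \<inter> W_of I)"
    unfolding open_compact_Pr_s_iff finite_type_ideal_def eq by metis
next
  fix \<U> :: "'a set set set"
  assume "finite \<U>" "\<forall>U\<in>\<U>. openin Pr_s_topology U \<and> compactin Pr_s_topology U"
  then show "openin Pr_s_topology (Pr_s \<inter> \<Inter>\<U>)" "compactin Pr_s_topology (Pr_s \<inter> \<Inter>\<U>)"
    using open_compact_Pr_s_Inter by blast+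
next
  fix F :: "'a set set" assume "irreducible_closedin Pr_s_topology F"
  then show "\<exists>!p. generic_point_in Pr_s_topology F p"
    by (rule irreducible_closedin_Pr_s_generic_point)
qed

end
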